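(* Consider the entropy-regularized tabular MDP described in the context. The policy gradient objective $l$ satisfies the PŁK condition on $\Theta$ with constant $$\mu_l=\frac{\lambda^3\min\{\underline\rho,\underline p\}^3\,\underline\theta^2}{e\,n^4T^2\big[2T\bar C+\lambda+\lambda T\log((T\bar C+\lambda)/\lambda)\big]^2},$$ i.e. $$l(\theta)-l(\theta^* )\le\frac1{2\mu_l}\min_{g\in N_\Theta(\theta)}\|\nabla l(\theta)+g\|_F^2\qquad\forall\theta\in\Theta.$$
   Context: Entropy-regularized tabular MDP: horizon $T$, states $\mathcal S=\{1,\dots,m\}$, base actions $\mathcal N=\{1,\dots,n\}$. At period $t$ a randomized policy is given by a matrix $\theta_t\in\mathbb R^{m\times n}$ whose row $\theta_t(s,\cdot)$ is a probability vector on $\mathcal N$. Base costs satisfy $0\le C_t(s,i)\le\bar C$; base transition probabilities satisfy $P_t(s'|s,i)\ge\underline p>0$ for all $s,s',i,t$; initial distribution satisfies $\rho(s)\ge\underline\rho>0$ for all $s$. Under $\theta$, the transition probabilities are $\sum_i\theta_t(s,i)P_t(s'|s,i)$ and the regularized per-period cost is $\sum_i\theta_t(s,i)C_t(s,i)+\lambda\mathcal R(\theta_t(s,\cdot))$ with $\lambda>0$ and $\mathcal R(p)=\sum_{i=1}^n\frac1n\log\frac{1/n}{p_i}$. $l(\theta)$ is the expected total regularized cost over periods $1,\dots,T$ with $s_1\sim\rho$. Feasible set: $\underline\theta=\lambda/(n\bar CT+n\lambda)$, $\Theta_t=\{\theta_t\in\mathbb R^{m\times n}:\sum_i\theta_t(s,i)=1,\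 \theta_t(s,i)\ge\underline\theta\ \forall s,i\}$, $\Theta=\Theta_1\times\dots\times\Theta_T$; $\theta^*$ is a minimizer of $l$ over $\Theta$ (it yields an optimal policy). $\nabla l(\theta)$ is the array of partial derivatives of $l$ with respect to the entries $\theta_t(s,i)$, $\|\cdot\|_F$ the Frobenius norm (square root of the sum of squares of all entries over all $t$), and $N_\Theta(\theta)=\{g:\langle g,\theta'-\theta\rangle\le0\ \forall\theta'\in\Theta\}$ the normal cone. The PŁK condition with constant $\mu_l>0$ means exactly the displayed inequality. *)

theory Defs
  imports "HOL-Probability.Probability"
begin

text \<open>
  States and actions are the finite types \<^typ>\<open>'m\<close> and \<^typ>\<open>'n\<close>. An array over all periods is a
  function \<^typ>\<open>nat \<Rightarrow> real^'n^'m\<close>, of which only the values at \<open>1..T\<close> matter; the entry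
  \<open>\<theta> t $ s $ i\<close> is $\theta_t(s,i)$. On \<^typ>\<open>real^'n^'m\<close> the library's \<open>norm\<close> and \<open>\<bullet>\<close> are the
  Frobenius norm and inner product.
\<close>

definition transition_prob ::
    "(nat \<Rightarrow> 'm::finite \<Rightarrow> 'n::finite \<Rightarrow> 'm pmf) \<Rightarrow> (nat \<Rightarrow> real^'n^'m) \<Rightarrow> nat \<Rightarrow> 'm \<Rightarrow> 'm \<Rightarrow> real"
  where "transition_prob P \<theta> t s s' = (\<Sum>i\<in>UNIV. \<theta> t $ s $ i * pmf (P t s i) s')"

definition regularizer :: "real^'n::finite \<Rightarrow> real"
  where "regularizer p = (\<Sum>i\<in>UNIV. (1 / real CARD('n)) * ln ((1 / real CARD('n)) / p $ i))"

definition period_cost ::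
    "real \<Rightarrow> (nat \<Rightarrow> 'm::finite \<Rightarrow> 'n::finite \<Rightarrow> real) \<Rightarrow> (nat \<Rightarrow> real^'n^'m) \<Rightarrow> nat \<Rightarrow> 'm \<Rightarrow> real"
  where "period_cost lam C \<theta> t s =
    (\<Sum>i\<in>UNIV. \<theta> t $ s $ i * C t s i) + lam * regularizer (\<theta> t $ s)"

definition trajectory_prob ::
    "nat \<Rightarrow> (nat \<Rightarrow> 'm::finite \<Rightarrow> 'n::finite \<Rightarrow> 'm pmf) \<Rightarrow> 'm pmf \<Rightarrow> (nat \<Rightarrow> real^'n^'m)
      \<Rightarrow> (nat \<Rightarrow> 'm) \<Rightarrow> real"
  where "trajectory_prob T P \<rho> \<theta> \<tau> =
    pmf \<rho> (\<tau> 1) * (\<Prod>t\<in>{1..<T}. transition_prob P \<theta> t (\<tau> t) (\<tau> (Suc t)))"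

text \<open>
  The expected total cost is the sum over all state trajectories $(s_1,\dots,s_T)$ of probability
  times total cost. The formula makes sense for every array \<open>\<theta>\<close>, feasible or not, as needed for
  partial derivatives in single entries. Another smooth extension off the constraints
  $\sum_i \theta_t(s,i) = 1$ would change the gradient only by arrays with constant rows, and
  these belong to the (conic) normal cone together with their negatives.
\<close>

definition expected_cost ::
    "nat \<Rightarrow> real \<Rightarrow> (nat \<Rightarrow> 'm::finite \<Rightarrow> 'n::finite \<Rightarrow> real) \<Rightarrow> (nat \<Rightarrow> 'm \<Rightarrow> 'n \<Rightarrow> 'm pmf) \<Rightarrow> 'm pmf
      \<Rightarrow> (nat \<Rightarrow> real^'n^'m) \<Rightarrow> real"
  where "expected_cost T lam C P \<rho> \<theta> =
    (\<Sum>\<tau>\<in>{1..T} \<rightarrow>\<^sub>E UNIV.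
      trajectory_prob T P \<rho> \<theta> \<tau> * (\<Sum>t=1..T. period_cost lam C \<theta> t (\<tau> t)))"

definition theta_low :: "nat \<Rightarrow> nat \<Rightarrow> real \<Rightarrow> real \<Rightarrow> real"
  where "theta_low n T lam Cbar = lam / (real n * Cbar * real T + real n * lam)"

definition stage_policies :: "real \<Rightarrow> (real^'n::finite^'m::finite) set"
  where "stage_policies b = {A. \<forall>s. (\<Sum>i\<in>UNIV. A $ s $ i) = 1 \<and> (\<forall>i. A $ s $ i \<ge> b)}"

definition policies :: "nat \<Rightarrow> real \<Rightarrow> (nat \<Rightarrow> real^'n::finite^'m::finite) set"
  where "policies T b = {1..T} \<rightarrow>\<^sub>E stage_policies b"

definition frobenius_norm :: "nat \<Rightarrow> (nat \<Rightarrow> real^'n::finite^'m::finite) \<Rightarrow> real"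
  where "frobenius_norm T G = sqrt (\<Sum>t=1..T. (norm (G t))\<^sup>2)"

definition normal_cone ::
    "nat \<Rightarrow> (nat \<Rightarrow> real^'n::finite^'m::finite) set \<Rightarrow> (nat \<Rightarrow> real^'n^'m)
      \<Rightarrow> (nat \<Rightarrow> real^'n^'m) set"
  where "normal_cone T X \<theta> = {g. \<forall>\<theta>'\<in>X. (\<Sum>t=1..T. g t \<bullet> (\<theta>' t - \<theta> t)) \<le> 0}"

definition partials ::
    "((nat \<Rightarrow> real^'n::finite^'m::finite) \<Rightarrow> real) \<Rightarrow> (nat \<Rightarrow> real^'n^'m) \<Rightarrow> nat \<Rightarrow> real^'n^'m"
  where "partials f \<theta> t = (\<chi> s i.
    deriv (\<lambda>x. f (\<theta>(t := (\<chi> s' i'. if s' = s \<and> i' = i then x else \<theta> t $ s' $ i')))) (\<theta> t $ s $ i))"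

text \<open>
  The PLK (Polyak-Lojasiewicz-Kurdyka) condition for \<open>f\<close> on \<open>X\<close>, with \<open>\<theta>opt\<close> a minimizer. The
  minimum over the normal cone is rendered with a minimizing \<open>g\<close>, so its attainment is part of the
  condition.
\<close>

definition PLK_condition ::
    "nat \<Rightarrow> ((nat \<Rightarrow> real^'n::finite^'m::finite) \<Rightarrow> real) \<Rightarrow> (nat \<Rightarrow> real^'n^'m) set
      \<Rightarrow> (nat \<Rightarrow> real^'n^'m) \<Rightarrow> real \<Rightarrow> bool"
  where "PLK_condition T f X \<theta>opt \<mu> \<longleftrightarrow> \<mu> > 0 \<and>
    (\<forall>\<theta>\<in>X. \<exists>g. is_arg_min (\<lambda>g. (frobenius_norm T (\<lambda>t. partials f \<theta> t + g t))\<^sup>2)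
                 (\<lambda>g. g \<in> normal_cone T X \<theta>) g \<and>
      f \<theta> - f \<theta>opt \<le> 1 / (2 * \<mu>) * (frobenius_norm T (\<lambda>t. partials f \<theta> t + g t))\<^sup>2)"

definition PLK_constant :: "nat \<Rightarrow> nat \<Rightarrow> real \<Rightarrow> real \<Rightarrow> real \<Rightarrow> real \<Rightarrow> real"
  where "PLK_constant n T lam Cbar plow \<rho>low =
    lam ^ 3 * (min \<rho>low plow) ^ 3 * (theta_low n T lam Cbar)\<^sup>2 /
    (exp 1 * real n ^ 4 * (real T)\<^sup>2 *
      (2 * real T * Cbar + lam + lam * real T * ln ((real T * Cbar + lam) / lam))\<^sup>2)"

end

theory Submission imports Defs begin

text \<open>
  By the performance difference lemma, \<open>l(\<theta>) - l(\<theta>\<^sup>*)\<close> is the sum over \<open>t\<close> and \<open>s\<close> of the probability that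
  \<open>\<theta>\<^sup>*\<close> visits \<open>s\<close> at time \<open>t\<close>, times the one-step advantage of \<open>\<theta>\<^sub>t(s,\<cdot>)\<close> over \<open>\<theta>\<^sup>*\<^sub>t(s,\<cdot>)\<close> in the cost
  \<open>f(p) = \<langle>Q\<^sub>t(s,\<cdot>), p\<rangle> + \<lambda> R(p)\<close>, where \<open>Q\<close> belongs to \<open>\<theta>\<close>. Since \<open>-ln\<close> is 1-strongly convex on
  \<open>(0,1]\<close>, \<open>f\<close> is \<open>\<lambda>/n\<close>-strongly convex on the simplex. Up to a constant on the row, the \<open>(t,s)\<close>-row of
  \<open>\<nabla>l(\<theta>)\<close> is \<open>\<nabla>f(\<theta>\<^sub>t(s,\<cdot>))\<close> times the probability that \<open>\<theta>\<close> visits \<open>s\<close> at time \<open>t\<close>, which is at least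
  \<open>\<delta> = min {\<rho>low, plow}\<close>. This gives the condition even with the larger constant \<open>\<lambda> \<delta>\<^sup>2 / n\<close>.
\<close>

section \<open>Strong concavity of the logarithm and sums over trajectories\<close>

text \<open>Up to a constant, the right side minus the left is \<open>\<phi>\<close>. Its derivative
  at \<open>z\<close> is \<open>z - x\<close> times a factor that is nonnegative on (0,1], so
  \<open>\<phi>\<close> is minimal at \<open>x\<close>.\<close>

lemma ln_strongly_concave:
  fixes x y :: real
  assumes "0 < x" "x \<le> 1" "0 < y" "y \<le> 1"
  shows "ln y - ln x \<le> (y - x) / x - (y - x)\<^sup>2 / 2"
proof -
  define \<phi> where "\<phi> = (\<lambda>z. (z - x) / x - (z - x)\<^sup>2 / 2 - ln z)"
  have der: "(\<phi> has_real_derivative (z - x) * (1 / (x * z) - 1)) (at z)" if "0 < z" for z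
    unfolding \<phi>_def using that assms
    by (auto intro!: derivative_eq_intros simp: field_simps)
  have pos: "1 / (x * z) - 1 \<ge> 0" if "0 < z" "z \<le> 1" for z
    using that assms by (simp add: field_simps mult_le_one)
  have "\<phi> x \<le> \<phi> y"
  proof (cases "x \<le> y")
    case True
    show ?thesis
    proof (rule DERIV_nonneg_imp_nondecreasing[OF True])
      fix z assume "x \<le> z" "z \<le> y"
      with assms show "\<exists>d. DERIV \<phi> z :> d \<and> d \<ge> 0"
        by (intro exI[of _ "(z - x) * (1 / (x * z) - 1)"] conjI der mult_nonneg_nonneg pos) auto
    qed
  next
    case False
    show ?thesis
    proof (rule DERIV_nonpos_imp_nonincreasing[of y x])
      fix z assume "y \<le> z" "z \<le> x"
      with assms show "\<exists>d. DERIV \<phi> z :> d \<and> d \<le> 0"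
        by (intro exI[of _ "(z - x) * (1 / (x * z) - 1)"] conjI der mult_nonpos_nonneg pos) auto
    qed (use False in simp)
  qed
  then show ?thesis by (simp add: \<phi>_def)
qed

text \<open>Appending a last state is a bijection. This drives the inductions on trajectory
  length.\<close>

lemma sum_PiE_UNIV_Suc:
  fixes f :: "(nat \<Rightarrow> 'm::finite) \<Rightarrow> real"
  shows "(\<Sum>\<tau>\<in>{1..Suc k} \<rightarrow>\<^sub>E UNIV. f \<tau>) = (\<Sum>\<tau>\<in>{1..k} \<rightarrow>\<^sub>E UNIV. \<Sum>s\<in>UNIV. f (\<tau>(Suc k := s)))"
proof -
  have "{1..Suc k} = insert (Suc k) {1..k}" by auto
  then have "(\<Sum>\<tau>\<in>{1..Suc k} \<rightarrow>\<^sub>E UNIV. f \<tau>) =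
      (\<Sum>\<tau>\<in>(\<lambda>(y, g). g(Suc k := y)) ` (UNIV \<times> ({1..k} \<rightarrow>\<^sub>E UNIV)). f \<tau>)"
    by (simp only: PiE_insert_eq)
  also have "\<dots> = (\<Sum>z\<in>UNIV \<times> ({1..k} \<rightarrow>\<^sub>E UNIV). f ((\<lambda>(y, g). g(Suc k := y)) z))"
    using inj_combinator[of "Suc k" "{1..k}" "\<lambda>_. UNIV"]
    by (intro sum.reindex[unfolded o_def]) auto
  also have "\<dots> = (\<Sum>s\<in>UNIV. \<Sum>\<tau>\<in>{1..k} \<rightarrow>\<^sub>E UNIV. f (\<tau>(Suc k := s)))"
    by (simp add: sum.cartesian_product case_prod_beta)
  also have "\<dots> = (\<Sum>\<tau>\<in>{1..k} \<rightarrow>\<^sub>E UNIV. \<Sum>s\<in>UNIV. f (\<tau>(Suc k := s)))"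
    by (rule sum.swap)
  finally show ?thesis .
qed

lemma trajectory_prob_Suc:
  "trajectory_prob (Suc (Suc k)) P \<rho> \<theta> (\<tau>(Suc (Suc k) := s)) =
    trajectory_prob (Suc k) P \<rho> \<theta> \<tau> * transition_prob P \<theta> (Suc k) (\<tau> (Suc k)) s"
proof -
  have "(\<Prod>t\<in>{1..<Suc k}. transition_prob P \<theta> t ((\<tau>(Suc (Suc k) := s)) t) ((\<tau>(Suc (Suc k) := s)) (Suc t)))
      = (\<Prod>t\<in>{1..<Suc k}. transition_prob P \<theta> t (\<tau> t) (\<tau> (Suc t)))"
    by (rule prod.cong) auto
  then show ?thesis by (simp add: trajectory_prob_def)
qed

lemma sum_pmf_UNIV: "(\<Sum>x\<in>UNIV. pmf p x) = 1" for p :: "'a::finite pmf"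
  by (rule sum_pmf_eq_1) auto

text \<open>The row sum is kept rather than set to 1, because partial derivatives move a single
  entry and leave the simplex.\<close>

lemma sum_transition_prob:
  "(\<Sum>s'\<in>UNIV. transition_prob P \<theta> t s s') = (\<Sum>i\<in>UNIV. \<theta> t $ s $ i)"
proof -
  have "(\<Sum>s'\<in>UNIV. transition_prob P \<theta> t s s') = (\<Sum>i\<in>UNIV. \<Sum>s'\<in>UNIV. \<theta> t $ s $ i * pmf (P t s i) s')"
    unfolding transition_prob_def by (rule sum.swap)
  then show ?thesis by (simp add: sum_distrib_left[symmetric] sum_pmf_UNIV)
qed

lemma norm_matrix_sq: "(norm A)\<^sup>2 = (\<Sum>s\<in>UNIV. \<Sum>i\<in>UNIV. (A $ s $ i)\<^sup>2)"
  for A :: "real^'n::finite^'m::finite"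
  unfolding power2_norm_eq_inner inner_vec_def by (simp add: power2_eq_square)

lemma inner_matrix: "A \<bullet> B = (\<Sum>s\<in>UNIV. \<Sum>i\<in>UNIV. A $ s $ i * B $ s $ i)"
  for A B :: "real^'n::finite^'m::finite"
  by (simp add: inner_vec_def)

subsection \<open>Normal cones of product sets\<close>

text \<open>The cone of a product is the product of the cones: test points that differ from
  \<open>\<theta>\<close> in one period only isolate the inequality of that period.\<close>

lemma normal_cone_PiE:
  assumes \<theta>: "\<theta> \<in> {1..T} \<rightarrow>\<^sub>E X"
  shows "g \<in> normal_cone T ({1..T} \<rightarrow>\<^sub>E X) \<theta> \<longleftrightarrow> (\<forall>t\<in>{1..T}. \<forall>A\<in>X. g t \<bullet> (A - \<theta> t) \<le> 0)"
    (is "?L \<longleftrightarrow> ?R")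
proof
  assume L: ?L
  show ?R
  proof (intro ballI)
    fix t A assume t: "t \<in> {1..T}" and A: "A \<in> X"
    have "\<theta>(t := A) \<in> {1..T} \<rightarrow>\<^sub>E X"
      using \<theta> t A by (auto simp: PiE_iff extensional_def)
    with L have "(\<Sum>u=1..T. g u \<bullet> ((\<theta>(t := A)) u - \<theta> u)) \<le> 0"
      unfolding normal_cone_def by blast
    also have "(\<Sum>u=1..T. g u \<bullet> ((\<theta>(t := A)) u - \<theta> u)) =
        (\<Sum>u=1..T. if u = t then g u \<bullet> (A - \<theta> u) else 0)"
      by (rule sum.cong) auto
    finally show "g t \<bullet> (A - \<theta> t) \<le> 0" using t by simp
  qed
next
  assume ?R
  then show ?L unfolding normal_cone_def
    by (auto intro!: sum_nonpos simp: PiE_iff)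
qed

text \<open>The cone splits over the periods into closed sets \<open>K t\<close> containing 0, and
  the objective is a sum over the periods. So a nearest point of \<open>K t\<close> to
  \<open>- D t\<close>, chosen separately for each \<open>t\<close>, is a minimizer.\<close>

lemma normal_cone_min_attained:
  assumes \<theta>: "\<theta> \<in> {1..T} \<rightarrow>\<^sub>E X"
  shows "\<exists>g. is_arg_min (\<lambda>g. (frobenius_norm T (\<lambda>t. D t + g t))\<^sup>2)
    (\<lambda>g. g \<in> normal_cone T ({1..T} \<rightarrow>\<^sub>E X) \<theta>) g"
proof -
  define K where "K t = (\<Inter>A\<in>X. {h. h \<bullet> (A - \<theta> t) \<le> 0})" for t
  have "closed (K t)" for t
    unfolding K_def by (intro closed_INT ballI closed_Collect_le continuous_intros)
  moreover have "0 \<in> K t" for t by (simp add: K_def)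
  ultimately have "\<exists>h\<in>K t. \<forall>h'\<in>K t. dist (- D t) h \<le> dist (- D t) h'" for t
    by (metis distance_attains_inf empty_iff)
  then obtain g where g: "\<And>t. g t \<in> K t"
    and min: "\<And>t h'. h' \<in> K t \<Longrightarrow> dist (- D t) (g t) \<le> dist (- D t) h'"
    by metis
  have "\<not> (frobenius_norm T (\<lambda>t. D t + h t))\<^sup>2 < (frobenius_norm T (\<lambda>t. D t + g t))\<^sup>2"
    if "h \<in> normal_cone T ({1..T} \<rightarrow>\<^sub>E X) \<theta>" for h
  proof -
    have "norm (D t + g t) \<le> norm (D t + h t)" if "t \<in> {1..T}" for t
    proof -
      have "h t \<in> K t"
        using \<open>h \<in> _\<close> that unfolding normal_cone_PiE[OF \<theta>] K_def by auto
      then show ?thesis using min[of "h t" t]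
        by (simp add: dist_norm norm_minus_commute add.commute)
    qed
    then have "(\<Sum>t=1..T. (norm (D t + g t))\<^sup>2) \<le> (\<Sum>t=1..T. (norm (D t + h t))\<^sup>2)"
      by (intro sum_mono power_mono) auto
    then show ?thesis by (simp add: frobenius_norm_def sum_nonneg)
  qed
  moreover have "g \<in> normal_cone T ({1..T} \<rightarrow>\<^sub>E X) \<theta>"
    using g unfolding normal_cone_PiE[OF \<theta>] K_def by auto
  ultimately show ?thesis unfolding is_arg_min_def by blast
qed

subsection \<open>Cost decompositions\<close>

locale entropy_regularized_mdp =
  fixes T :: nat
    and lam :: real
    and C :: "nat \<Rightarrow> 'm::finite \<Rightarrow> 'n::finite \<Rightarrow> real"
    and P :: "nat \<Rightarrow> 'm \<Rightarrow> 'n \<Rightarrow> 'm pmf"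
    and \<rho> :: "'m pmf"
begin

abbreviation "cost \<equiv> period_cost lam C"
abbreviation "step_prob \<equiv> transition_prob P"
abbreviation "total_cost \<equiv> expected_cost T lam C P \<rho>"

text \<open>
  \<open>visit \<theta> k s\<close> is the probability of \<open>s\<close> at period \<open>k + 1\<close>, \<open>accrued \<theta> k s\<close> the expectation, on that event,
  of the costs of periods \<open>1..k\<close>, and \<open>cost_to_go \<theta> j s\<close> the expected cost of the last \<open>j\<close> periods
  started in \<open>s\<close>.
\<close>

primrec visit :: "(nat \<Rightarrow> real^'n^'m) \<Rightarrow> nat \<Rightarrow> 'm \<Rightarrow> real" where
  "visit \<theta> 0 s = pmf \<rho> s"
| "visit \<theta> (Suc k) s = (\<Sum>r\<in>UNIV. visit \<theta> k r * step_prob \<theta> (Suc k) r s)"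

primrec accrued :: "(nat \<Rightarrow> real^'n^'m) \<Rightarrow> nat \<Rightarrow> 'm \<Rightarrow> real" where
  "accrued \<theta> 0 s = 0"
| "accrued \<theta> (Suc k) s =
    (\<Sum>r\<in>UNIV. (accrued \<theta> k r + visit \<theta> k r * cost \<theta> (Suc k) r) * step_prob \<theta> (Suc k) r s)"

primrec cost_to_go :: "(nat \<Rightarrow> real^'n^'m) \<Rightarrow> nat \<Rightarrow> 'm \<Rightarrow> real" where
  "cost_to_go \<theta> 0 s = 0"
| "cost_to_go \<theta> (Suc j) s =
    cost \<theta> (T - j) s + (\<Sum>r\<in>UNIV. step_prob \<theta> (T - j) s r * cost_to_go \<theta> j r)"

section \<open>Trajectory sums as forward recursions\<close>

text \<open>Generalizing over \<open>f\<close> lets the induction absorb the last transition into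
  the test function. The identity is purely algebraic, so it also holds for arrays off the
  simplex.\<close>

lemma sum_trajectory_prob:
  "(\<Sum>\<tau>\<in>{1..Suc k} \<rightarrow>\<^sub>E UNIV. trajectory_prob (Suc k) P \<rho> \<theta> \<tau> * f (\<tau> (Suc k))) =
    (\<Sum>s\<in>UNIV. visit \<theta> k s * f s)"
proof (induction k arbitrary: f)
  case 0
  show ?case
    using sum_PiE_UNIV_Suc[of "\<lambda>\<tau>. pmf \<rho> (\<tau> 1) * f (\<tau> 1)" 0] by (simp add: trajectory_prob_def)
next
  case (Suc k)
  have "(\<Sum>\<tau>\<in>{1..Suc (Suc k)} \<rightarrow>\<^sub>E UNIV. trajectory_prob (Suc (Suc k)) P \<rho> \<theta> \<tau> * f (\<tau> (Suc (Suc k)))) =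
     (\<Sum>\<tau>\<in>{1..Suc k} \<rightarrow>\<^sub>E UNIV. trajectory_prob (Suc k) P \<rho> \<theta> \<tau> *
        (\<Sum>s\<in>UNIV. step_prob \<theta> (Suc k) (\<tau> (Suc k)) s * f s))"
    by (subst sum_PiE_UNIV_Suc) (simp add: trajectory_prob_Suc sum_distrib_left mult.assoc)
  also have "\<dots> = (\<Sum>r\<in>UNIV. visit \<theta> k r * (\<Sum>s\<in>UNIV. step_prob \<theta> (Suc k) r s * f s))"
    by (rule Suc.IH)
  also have "\<dots> = (\<Sum>r\<in>UNIV. \<Sum>s\<in>UNIV. visit \<theta> k r * step_prob \<theta> (Suc k) r s * f s)"
    by (simp add: sum_distrib_left mult.assoc)
  also have "\<dots> = (\<Sum>s\<in>UNIV. visit \<theta> (Suc k) s * f s)"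
    by (subst sum.swap) (simp add: sum_distrib_right)
  finally show ?case .
qed

text \<open>Trajectories have \<open>k + 1\<close> states but only \<open>k\<close> costs are
  counted. In the induction, the costs through \<open>k\<close> fall to the hypothesis and the cost
  of period \<open>k + 1\<close> to \<open>sum_trajectory_prob\<close>.\<close>

lemma sum_trajectory_prob_cost:
  "(\<Sum>\<tau>\<in>{1..Suc k} \<rightarrow>\<^sub>E UNIV. trajectory_prob (Suc k) P \<rho> \<theta> \<tau> * (\<Sum>t=1..k. cost \<theta> t (\<tau> t)) * f (\<tau> (Suc k))) =
    (\<Sum>s\<in>UNIV. accrued \<theta> k s * f s)"
proof (induction k arbitrary: f)
  case 0
  show ?case by simp
next
  case (Suc k)
  define h where "h r = (\<Sum>s\<in>UNIV. step_prob \<theta> (Suc k) r s * f s)" for r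
  define S where "S \<tau> = (\<Sum>t=1..k. cost \<theta> t (\<tau> t))" for \<tau>
  have split: "(\<Sum>t=1..Suc k. cost \<theta> t ((\<tau>(Suc (Suc k) := s)) t)) = S \<tau> + cost \<theta> (Suc k) (\<tau> (Suc k))" for \<tau> s
  proof -
    have "(\<Sum>t=1..k. cost \<theta> t ((\<tau>(Suc (Suc k) := s)) t)) = S \<tau>"
      unfolding S_def by (rule sum.cong) auto
    then show ?thesis by simp
  qed
  have "(\<Sum>\<tau>\<in>{1..Suc (Suc k)} \<rightarrow>\<^sub>E UNIV. trajectory_prob (Suc (Suc k)) P \<rho> \<theta> \<tau> *
         (\<Sum>t=1..Suc k. cost \<theta> t (\<tau> t)) * f (\<tau> (Suc (Suc k)))) =
     (\<Sum>\<tau>\<in>{1..Suc k} \<rightarrow>\<^sub>E UNIV. trajectory_prob (Suc k) P \<rho> \<theta> \<tau> * S \<tau> * h (\<tau> (Suc k))) +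
     (\<Sum>\<tau>\<in>{1..Suc k} \<rightarrow>\<^sub>E UNIV. trajectory_prob (Suc k) P \<rho> \<theta> \<tau> *
        (cost \<theta> (Suc k) (\<tau> (Suc k)) * h (\<tau> (Suc k))))"
    unfolding sum.distrib[symmetric]
    by (subst sum_PiE_UNIV_Suc, intro sum.cong refl, unfold split trajectory_prob_Suc h_def)
      (simp add: sum_distrib_left sum.distrib[symmetric] algebra_simps)
  also have "\<dots> = (\<Sum>r\<in>UNIV. accrued \<theta> k r * h r) + (\<Sum>r\<in>UNIV. visit \<theta> k r * (cost \<theta> (Suc k) r * h r))"
    unfolding S_def Suc.IH sum_trajectory_prob[of k \<theta> "\<lambda>r. cost \<theta> (Suc k) r * h r"] ..
  also have "\<dots> = (\<Sum>r\<in>UNIV. \<Sum>s\<in>UNIV. (accrued \<theta> k r + visit \<theta> k r * cost \<theta> (Suc k) r) * step_prob \<theta> (Suc k) r s * f s)"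
    by (simp add: h_def sum_distrib_left sum.distrib[symmetric] algebra_simps)
  also have "\<dots> = (\<Sum>s\<in>UNIV. accrued \<theta> (Suc k) s * f s)"
    by (subst sum.swap) (simp add: sum_distrib_right)
  finally show ?case .
qed

lemma total_cost_eq:
  assumes "T = Suc k"
  shows "total_cost \<theta> = (\<Sum>s\<in>UNIV. accrued \<theta> k s + visit \<theta> k s * cost \<theta> T s)"
proof -
  have "total_cost \<theta> =
     (\<Sum>\<tau>\<in>{1..Suc k} \<rightarrow>\<^sub>E UNIV. trajectory_prob (Suc k) P \<rho> \<theta> \<tau> * (\<Sum>t=1..k. cost \<theta> t (\<tau> t)) * 1) +
     (\<Sum>\<tau>\<in>{1..Suc k} \<rightarrow>\<^sub>E UNIV. trajectory_prob (Suc k) P \<rho> \<theta> \<tau> * cost \<theta> (Suc k) (\<tau> (Suc k)))"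
    unfolding expected_cost_def assms sum.distrib[symmetric]
    by (simp add: algebra_simps)
  also have "\<dots> = (\<Sum>s\<in>UNIV. accrued \<theta> k s * 1) + (\<Sum>s\<in>UNIV. visit \<theta> k s * cost \<theta> (Suc k) s)"
    unfolding sum_trajectory_prob[of k \<theta> "cost \<theta> (Suc k)"] sum_trajectory_prob_cost[of k \<theta> "\<lambda>_. 1"] ..
  finally show ?thesis by (simp add: assms sum.distrib)
qed

section \<open>Telescoping and the performance difference\<close>

text \<open>Following \<open>\<eta>\<close> for the first \<open>k\<close> periods and \<open>\<theta>\<close> afterwards.\<close>

definition hybrid_cost :: "(nat \<Rightarrow> real^'n^'m) \<Rightarrow> (nat \<Rightarrow> real^'n^'m) \<Rightarrow> nat \<Rightarrow> real" where
  "hybrid_cost \<eta> \<theta> k = (\<Sum>s\<in>UNIV. accrued \<eta> k s + visit \<eta> k s * cost_to_go \<theta> (T - k) s)"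

text \<open>Sign convention: positive when using \<open>\<eta>\<close> for period
  \<open>Suc k\<close> alone, and \<open>\<theta>\<close> afterwards, is cheaper than
  \<open>\<theta>\<close> throughout.\<close>

definition advantage :: "(nat \<Rightarrow> real^'n^'m) \<Rightarrow> (nat \<Rightarrow> real^'n^'m) \<Rightarrow> nat \<Rightarrow> 'm \<Rightarrow> real" where
  "advantage \<eta> \<theta> k s = cost_to_go \<theta> (T - k) s -
    (cost \<eta> (Suc k) s + (\<Sum>r\<in>UNIV. step_prob \<eta> (Suc k) s r * cost_to_go \<theta> (T - Suc k) r))"

definition stochastic_at :: "(nat \<Rightarrow> real^'n^'m) \<Rightarrow> nat \<Rightarrow> bool" where
  "stochastic_at \<theta> t \<longleftrightarrow> (\<forall>s. (\<Sum>i\<in>UNIV. \<theta> t $ s $ i) = 1)"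

lemma cost_to_go_step:
  assumes "k < T"
  shows "cost_to_go \<theta> (T - k) s =
    cost \<theta> (Suc k) s + (\<Sum>r\<in>UNIV. step_prob \<theta> (Suc k) s r * cost_to_go \<theta> (T - Suc k) r)"
proof -
  have "T - k = Suc (T - Suc k)" "T - (T - Suc k) = Suc k" using assms by auto
  then show ?thesis by simp
qed

text \<open>The row sums of period \<open>Suc k\<close> stay as explicit factors: they are 1 in
  \<open>hybrid_cost_step\<close>, but vary with the perturbed entry in the gradient
  computation.\<close>

lemma sum_accrued_visit_Suc:
  "(\<Sum>s\<in>UNIV. accrued \<theta> (Suc k) s + visit \<theta> (Suc k) s * w s) =
    (\<Sum>r\<in>UNIV. (accrued \<theta> k r + visit \<theta> k r * cost \<theta> (Suc k) r) * (\<Sum>s\<in>UNIV. step_prob \<theta> (Suc k) r s)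
      + visit \<theta> k r * (\<Sum>s\<in>UNIV. step_prob \<theta> (Suc k) r s * w s))"
proof -
  have "(\<Sum>s\<in>UNIV. accrued \<theta> (Suc k) s + visit \<theta> (Suc k) s * w s) =
     (\<Sum>s\<in>UNIV. \<Sum>r\<in>UNIV. (accrued \<theta> k r + visit \<theta> k r * cost \<theta> (Suc k) r) * step_prob \<theta> (Suc k) r s +
        visit \<theta> k r * (step_prob \<theta> (Suc k) r s * w s))"
    by (simp add: sum_distrib_right sum.distrib mult.assoc)
  also have "\<dots> = (\<Sum>r\<in>UNIV. \<Sum>s\<in>UNIV. (accrued \<theta> k r + visit \<theta> k r * cost \<theta> (Suc k) r) * step_prob \<theta> (Suc k) r s +
        visit \<theta> k r * (step_prob \<theta> (Suc k) r s * w s))"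
    by (rule sum.swap)
  finally show ?thesis by (simp add: sum.distrib sum_distrib_left)
qed

text \<open>The two hybrids differ only in the policy of period \<open>Suc k\<close>; with row sums
  1 the accrued costs cancel.\<close>

lemma hybrid_cost_step:
  assumes "stochastic_at \<eta> (Suc k)"
  shows "hybrid_cost \<eta> \<theta> k - hybrid_cost \<eta> \<theta> (Suc k) = (\<Sum>s\<in>UNIV. visit \<eta> k s * advantage \<eta> \<theta> k s)"
  using assms
  by (simp add: hybrid_cost_def sum_accrued_visit_Suc sum_transition_prob stochastic_at_def
      advantage_def sum_subtractf[symmetric] algebra_simps del: accrued.simps visit.simps)

lemma hybrid_cost_self:
  assumes "k \<le> T" "\<And>t. k < t \<Longrightarrow> t \<le> T \<Longrightarrow> stochastic_at \<theta> t"
  shows "hybrid_cost \<theta> \<theta> k = hybrid_cost \<theta> \<theta> T"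
  using assms
proof (induction k rule: inc_induct)
  case (step j)
  have "hybrid_cost \<theta> \<theta> j - hybrid_cost \<theta> \<theta> (Suc j) = 0"
    using step by (subst hybrid_cost_step) (auto simp: advantage_def cost_to_go_step)
  with step show ?case by simp
qed simp

text \<open>Row sums 1 are required only after period \<open>k\<close>, so this applies to arrays
  perturbed in period \<open>k\<close>. At \<open>k = T\<close> the hybrid would carry the row sums
  of period \<open>T\<close> as factors, hence the strict bound.\<close>

lemma total_cost_hybrid:
  assumes "k < T" "\<And>t. k < t \<Longrightarrow> t \<le> T \<Longrightarrow> stochastic_at \<theta> t"
  shows "total_cost \<theta> = hybrid_cost \<theta> \<theta> k"
proof -
  obtain j where j: "T = Suc j" using assms by (cases T) auto
  \<comment> \<open>With one period left, the cost to go is just the cost of period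
    \<open>T\<close>.\<close>
  have "total_cost \<theta> = hybrid_cost \<theta> \<theta> j"
  proof -
    have "j < T" "T - Suc j = 0" using j by auto
    then show ?thesis
      by (simp add: total_cost_eq[OF j] hybrid_cost_def cost_to_go_step) (simp add: j)
  qed
  also have "\<dots> = hybrid_cost \<theta> \<theta> T"
    using assms by (intro hybrid_cost_self) (auto simp: j)
  finally show ?thesis using hybrid_cost_self[of k \<theta>] assms by simp
qed

text \<open>The hybrids interpolate from \<open>\<theta>\<close> at \<open>k = 0\<close> to
  \<open>\<eta>\<close> at \<open>k = T\<close>, and their successive differences telescope.\<close>

lemma performance_difference:
  assumes "T \<ge> 1" "\<And>t. t \<in> {1..T} \<Longrightarrow> stochastic_at \<theta> t" "\<And>t. t \<in> {1..T} \<Longrightarrow> stochastic_at \<eta> t"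
  shows "total_cost \<theta> - total_cost \<eta> = (\<Sum>k<T. \<Sum>s\<in>UNIV. visit \<eta> k s * advantage \<eta> \<theta> k s)"
proof -
  have "total_cost \<theta> = hybrid_cost \<eta> \<theta> 0"
    using assms by (subst total_cost_hybrid[of 0]) (auto simp: hybrid_cost_def)
  moreover have "total_cost \<eta> = hybrid_cost \<eta> \<theta> T"
    using assms hybrid_cost_self[of 0 \<eta>]
    by (subst total_cost_hybrid[of 0]) (auto simp: hybrid_cost_def)
  moreover have "(\<Sum>k<T. hybrid_cost \<eta> \<theta> k - hybrid_cost \<eta> \<theta> (Suc k)) = hybrid_cost \<eta> \<theta> 0 - hybrid_cost \<eta> \<theta> T"
    by (rule sum_lessThan_telescope')
  moreover have "hybrid_cost \<eta> \<theta> k - hybrid_cost \<eta> \<theta> (Suc k) = (\<Sum>s\<in>UNIV. visit \<eta> k s * advantage \<eta> \<theta> k s)"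
    if "k < T" for k
    using that assms by (intro hybrid_cost_step) auto
  ultimately show ?thesis by simp
qed

section \<open>Dependence on past or future periods only\<close>

lemma transition_prob_cong: "\<theta> t = \<eta> t \<Longrightarrow> step_prob \<theta> t = step_prob \<eta> t"
  by (simp add: transition_prob_def fun_eq_iff)

lemma period_cost_cong: "\<theta> t = \<eta> t \<Longrightarrow> cost \<theta> t = cost \<eta> t"
  by (simp add: period_cost_def fun_eq_iff)

lemma visit_cong:
  assumes "\<And>t. t \<le> k \<Longrightarrow> \<theta> t = \<eta> t"
  shows "visit \<theta> k = visit \<eta> k"
  using assms
proof (induction k)
  case (Suc k)
  then show ?case using transition_prob_cong[of \<theta> "Suc k" \<eta>] by (simp add: fun_eq_iff)
qed (simp add: fun_eq_iff)

lemma accrued_cong: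
  assumes "\<And>t. t \<le> k \<Longrightarrow> \<theta> t = \<eta> t"
  shows "accrued \<theta> k = accrued \<eta> k"
  using assms
proof (induction k)
  case (Suc k)
  then show ?case
    using transition_prob_cong[of \<theta> "Suc k" \<eta>] period_cost_cong[of \<theta> "Suc k" \<eta>] visit_cong[of k \<theta> \<eta>]
    by (simp add: fun_eq_iff)
qed (simp add: fun_eq_iff)

lemma cost_to_go_cong:
  assumes "\<And>t. T - j < t \<Longrightarrow> \<theta> t = \<eta> t" "j \<le> T"
  shows "cost_to_go \<theta> j = cost_to_go \<eta> j"
  using assms
proof (induction j)
  case (Suc j)
  have "\<theta> (T - j) = \<eta> (T - j)" using Suc.prems by auto
  then show ?case
    using transition_prob_cong[of \<theta> "T - j" \<eta>] period_cost_cong[of \<theta> "T - j" \<eta>] Suc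
    by (simp add: fun_eq_iff)
qed (simp add: fun_eq_iff)

section \<open>One-step costs and their strong convexity\<close>

text \<open>The Q-function of period \<open>Suc k\<close>, without the regularizer of that
  period.\<close>

definition action_value :: "(nat \<Rightarrow> real^'n^'m) \<Rightarrow> nat \<Rightarrow> 'm \<Rightarrow> 'n \<Rightarrow> real" where
  "action_value \<theta> k s i = C (Suc k) s i +
    (\<Sum>r\<in>UNIV. pmf (P (Suc k) s i) r * cost_to_go \<theta> (T - Suc k) r)"

definition advantage_grad :: "(nat \<Rightarrow> real^'n^'m) \<Rightarrow> nat \<Rightarrow> 'm \<Rightarrow> 'n \<Rightarrow> real" where
  "advantage_grad \<theta> k s i = action_value \<theta> k s i - lam / (real CARD('n) * \<theta> (Suc k) $ s $ i)"

lemma cost_plus_value: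
  "cost \<eta> (Suc k) s + (\<Sum>r\<in>UNIV. step_prob \<eta> (Suc k) s r * cost_to_go \<theta> (T - Suc k) r) =
    (\<Sum>i\<in>UNIV. \<eta> (Suc k) $ s $ i * action_value \<theta> k s i) + lam * regularizer (\<eta> (Suc k) $ s)"
proof -
  have "(\<Sum>r\<in>UNIV. step_prob \<eta> (Suc k) s r * cost_to_go \<theta> (T - Suc k) r) =
     (\<Sum>i\<in>UNIV. \<Sum>r\<in>UNIV. \<eta> (Suc k) $ s $ i * (pmf (P (Suc k) s i) r * cost_to_go \<theta> (T - Suc k) r))"
    by (subst sum.swap) (simp add: transition_prob_def sum_distrib_right mult.assoc)
  then show ?thesis
    by (simp add: period_cost_def action_value_def sum_distrib_left sum.distrib distrib_left)
qed

text \<open>The Q-part is linear and enters exactly; only the logarithms are estimated, entry by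
  entry, by \<open>ln_strongly_concave\<close> with weight \<open>lam / n\<close>.\<close>

lemma advantage_le:
  assumes "lam > 0" "k < T"
    and \<theta>: "\<And>i. 0 < \<theta> (Suc k) $ s $ i" "\<And>i. \<theta> (Suc k) $ s $ i \<le> 1"
    and \<eta>: "\<And>i. 0 < \<eta> (Suc k) $ s $ i" "\<And>i. \<eta> (Suc k) $ s $ i \<le> 1"
  shows "advantage \<eta> \<theta> k s \<le>
    (\<Sum>i\<in>UNIV. (\<theta> (Suc k) $ s $ i - \<eta> (Suc k) $ s $ i) * advantage_grad \<theta> k s i
      - lam / real CARD('n) / 2 * (\<theta> (Suc k) $ s $ i - \<eta> (Suc k) $ s $ i)\<^sup>2)"
proof -
  let ?x = "\<lambda>i. \<theta> (Suc k) $ s $ i" and ?y = "\<lambda>i. \<eta> (Suc k) $ s $ i"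
  have R: "regularizer (\<theta> (Suc k) $ s) - regularizer (\<eta> (Suc k) $ s) =
      (\<Sum>i\<in>UNIV. 1 / real CARD('n) * (ln (?y i) - ln (?x i)))"
  proof -
    have "ln (1 / real CARD('n) / z) = ln (1 / real CARD('n)) - ln z" if "0 < z" for z
      using that by (intro ln_divide_pos) auto
    then show ?thesis
      using \<theta>(1) \<eta>(1)
      by (simp add: regularizer_def sum_subtractf[symmetric] right_diff_distrib del: divide_divide_eq_left)
  qed
  have "advantage \<eta> \<theta> k s = (\<Sum>i\<in>UNIV. ?x i * action_value \<theta> k s i) - (\<Sum>i\<in>UNIV. ?y i * action_value \<theta> k s i)
      + lam * (regularizer (\<theta> (Suc k) $ s) - regularizer (\<eta> (Suc k) $ s))"
    using \<open>k < T\<close> by (simp add: advantage_def cost_to_go_step cost_plus_value algebra_simps)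
  also have "\<dots> = (\<Sum>i\<in>UNIV. (?x i - ?y i) * action_value \<theta> k s i + lam / real CARD('n) * (ln (?y i) - ln (?x i)))"
    unfolding R by (simp add: sum_distrib_left sum.distrib sum_subtractf left_diff_distrib)
  also have "\<dots> \<le> (\<Sum>i\<in>UNIV. (?x i - ?y i) * action_value \<theta> k s i
      + lam / real CARD('n) * ((?y i - ?x i) / ?x i - (?y i - ?x i)\<^sup>2 / 2))"
    using assms by (intro sum_mono add_left_mono mult_left_mono ln_strongly_concave) auto
  also have "\<dots> = (\<Sum>i\<in>UNIV. (?x i - ?y i) * advantage_grad \<theta> k s i - lam / real CARD('n) / 2 * (?x i - ?y i)\<^sup>2)"
  proof (intro sum.cong refl)
    fix i
    show "(?x i - ?y i) * action_value \<theta> k s i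
        + lam / real CARD('n) * ((?y i - ?x i) / ?x i - (?y i - ?x i)\<^sup>2 / 2) =
        (?x i - ?y i) * advantage_grad \<theta> k s i - lam / real CARD('n) / 2 * (?x i - ?y i)\<^sup>2"
      using \<theta>(1)[of i] by (simp add: advantage_grad_def field_simps power2_eq_square)
  qed
  finally show ?thesis .
qed

section \<open>The gradient of the total cost\<close>

text \<open>
  At the last period the total cost is not weighted by the row sum of \<open>\<theta>\<close>, so the constant \<open>\<kappa>\<close> vanishes
  there; at earlier periods it is \<open>accrued \<theta> k s + visit \<theta> k s * cost \<theta> (Suc k) s\<close>.
\<close>

lemma partials_total_cost:
  assumes "k < T" and st: "\<And>t. t \<in> {1..T} \<Longrightarrow> stochastic_at \<theta> t"
    and pos: "\<And>r j. 0 < \<theta> (Suc k) $ r $ j"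
  shows "\<exists>\<kappa>. \<forall>i. partials total_cost \<theta> (Suc k) $ s $ i = visit \<theta> k s * advantage_grad \<theta> k s i + \<kappa>"
proof -
  define \<kappa> where "\<kappa> = (if Suc k < T then accrued \<theta> k s + visit \<theta> k s * cost \<theta> (Suc k) s else 0)"
  have "partials total_cost \<theta> (Suc k) $ s $ i = visit \<theta> k s * advantage_grad \<theta> k s i + \<kappa>" for i
  proof -
    define x0 where "x0 = \<theta> (Suc k) $ s $ i"
    define A where "A x = (\<chi> r j. if r = s \<and> j = i then x else \<theta> (Suc k) $ r $ j)" for x
    define \<xi> where "\<xi> x = \<theta>(Suc k := A x)" for x
    have A0: "A x0 = \<theta> (Suc k)" by (simp add: A_def x0_def vec_eq_iff)
    have \<xi>0: "\<xi> x0 = \<theta>" by (simp add: \<xi>_def A0)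
    have dA: "((\<lambda>x. A x $ r $ j) has_real_derivative (if r = s \<and> j = i then 1 else 0)) (at x0)" for r j
      by (auto simp: A_def)
    have dp: "((\<lambda>x. step_prob (\<xi> x) (Suc k) r r') has_real_derivative
        (if r = s then pmf (P (Suc k) s i) r' else 0)) (at x0)" for r r'
    proof -
      have "((\<lambda>x. step_prob (\<xi> x) (Suc k) r r') has_real_derivative
          (\<Sum>j\<in>UNIV. (if r = s \<and> j = i then 1 else 0) * pmf (P (Suc k) r j) r')) (at x0)"
        unfolding transition_prob_def \<xi>_def fun_upd_same
        by (intro DERIV_sum DERIV_cmult_right dA)
      moreover have "(\<Sum>j\<in>UNIV. (if r = s \<and> j = i then 1 else 0) * pmf (P (Suc k) r j) r') =
          (if r = s then pmf (P (Suc k) s i) r' else 0)"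
        by (simp add: if_distrib[of "\<lambda>x. x * _"] cong: if_cong)
      ultimately show ?thesis by simp
    qed
    define c' where "c' = C (Suc k) s i - lam / (real CARD('n) * x0)"
    have dc: "((\<lambda>x. cost (\<xi> x) (Suc k) r) has_real_derivative (if r = s then c' else 0)) (at x0)" for r
    proof -
      let ?d = "\<lambda>j. if r = s \<and> j = i then 1 else 0 :: real"
      have dln: "((\<lambda>x. ln (1 / real CARD('n) / A x $ r $ j)) has_real_derivative
          - ?d j / \<theta> (Suc k) $ r $ j) (at x0)" for j
        using pos[of r j]
        by (auto intro!: derivative_eq_intros dA simp: A0 field_simps)
      have "((\<lambda>x. cost (\<xi> x) (Suc k) r) has_real_derivative
          (\<Sum>j\<in>UNIV. ?d j * C (Suc k) r j) +
            lam * (\<Sum>j\<in>UNIV. 1 / real CARD('n) * (- ?d j / \<theta> (Suc k) $ r $ j))) (at x0)"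
        unfolding period_cost_def regularizer_def \<xi>_def fun_upd_same
        by (intro DERIV_add DERIV_sum DERIV_cmult DERIV_cmult_right dA dln)
      moreover have "(\<Sum>j\<in>UNIV. ?d j * C (Suc k) r j) +
            lam * (\<Sum>j\<in>UNIV. 1 / real CARD('n) * (- ?d j / \<theta> (Suc k) $ r $ j)) = (if r = s then c' else 0)"
        by (simp add: c'_def x0_def if_distrib[of "\<lambda>x. x * _"] if_distrib[of "\<lambda>x. x / _"]
            if_distrib[of uminus] sum_negf sum_divide_distrib[symmetric] cong: if_cong)
      ultimately show ?thesis by simp
    qed
    \<comment> \<open>Only period \<open>Suc k\<close> is perturbed, so everything before it is
      constant in \<open>x\<close>.\<close>
    have acc: "accrued (\<xi> x) k = accrued \<theta> k" and vis: "visit (\<xi> x) k = visit \<theta> k" for x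
      by (rule accrued_cong visit_cong; simp add: \<xi>_def)+
    have "((\<lambda>x. total_cost (\<xi> x)) has_real_derivative visit \<theta> k s * advantage_grad \<theta> k s i + \<kappa>) (at x0)"
    proof (cases "Suc k < T")
      case False
      with \<open>k < T\<close> have T: "T = Suc k" by simp
      have "((\<lambda>x. total_cost (\<xi> x)) has_real_derivative
          (\<Sum>r\<in>UNIV. 0 + visit \<theta> k r * (if r = s then c' else 0))) (at x0)"
        unfolding total_cost_eq[OF T] acc vis unfolding T
        by (intro DERIV_sum DERIV_add DERIV_const DERIV_cmult dc)
      then show ?thesis
        using False by (simp add: \<kappa>_def advantage_grad_def action_value_def c'_def x0_def
            if_distrib[of "\<lambda>x. _ * x"] cong: if_cong)
    next
      case True
      let ?V = "cost_to_go \<theta> (T - Suc k)"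
      have V: "cost_to_go (\<xi> x) (T - Suc k) = ?V" for x
        by (rule cost_to_go_cong) (use \<open>k < T\<close> in \<open>auto simp: \<xi>_def\<close>)
      \<comment> \<open>Cutting right after the perturbed period leaves \<open>x\<close> only in the
        cost and the transitions of that period.\<close>
      have "total_cost (\<xi> x) = (\<Sum>r\<in>UNIV.
          (accrued \<theta> k r + visit \<theta> k r * cost (\<xi> x) (Suc k) r) * (\<Sum>r'\<in>UNIV. step_prob (\<xi> x) (Suc k) r r')
           + visit \<theta> k r * (\<Sum>r'\<in>UNIV. step_prob (\<xi> x) (Suc k) r r' * ?V r'))" for x
      proof -
        have "stochastic_at (\<xi> x) t" if "Suc k < t" "t \<le> T" for t
          using st[of t] that by (simp add: stochastic_at_def \<xi>_def)
        then show ?thesis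
          using True by (subst total_cost_hybrid[of "Suc k"])
            (simp_all add: hybrid_cost_def sum_accrued_visit_Suc acc vis V del: accrued.simps visit.simps)
      qed
      moreover have "((\<lambda>x. \<Sum>r\<in>UNIV.
          (accrued \<theta> k r + visit \<theta> k r * cost (\<xi> x) (Suc k) r) * (\<Sum>r'\<in>UNIV. step_prob (\<xi> x) (Suc k) r r')
           + visit \<theta> k r * (\<Sum>r'\<in>UNIV. step_prob (\<xi> x) (Suc k) r r' * ?V r')) has_real_derivative
          (\<Sum>r\<in>UNIV. (0 + visit \<theta> k r * (if r = s then c' else 0)) * (\<Sum>r'\<in>UNIV. step_prob (\<xi> x0) (Suc k) r r')
           + (\<Sum>r'\<in>UNIV. if r = s then pmf (P (Suc k) s i) r' else 0) *
               (accrued \<theta> k r + visit \<theta> k r * cost (\<xi> x0) (Suc k) r)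
           + visit \<theta> k r * (\<Sum>r'\<in>UNIV. (if r = s then pmf (P (Suc k) s i) r' else 0) * ?V r'))) (at x0)"
        by (intro DERIV_sum DERIV_add DERIV_mult DERIV_const DERIV_cmult DERIV_cmult_right dc dp)
      \<comment> \<open>At \<open>x0\<close> the row sums are 1, and the base probabilities sum to 1
        for each action; so the middle term is the same for every \<open>i\<close> and becomes
        \<open>\<kappa>\<close>.\<close>
      moreover have "(\<Sum>r\<in>UNIV. (0 + visit \<theta> k r * (if r = s then c' else 0)) * (\<Sum>r'\<in>UNIV. step_prob (\<xi> x0) (Suc k) r r')
           + (\<Sum>r'\<in>UNIV. if r = s then pmf (P (Suc k) s i) r' else 0) *
               (accrued \<theta> k r + visit \<theta> k r * cost (\<xi> x0) (Suc k) r)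
           + visit \<theta> k r * (\<Sum>r'\<in>UNIV. (if r = s then pmf (P (Suc k) s i) r' else 0) * ?V r'))
         = (\<Sum>r\<in>UNIV. if r = s then visit \<theta> k s * c' + (accrued \<theta> k s + visit \<theta> k s * cost \<theta> (Suc k) s)
           + visit \<theta> k s * (\<Sum>r'\<in>UNIV. pmf (P (Suc k) s i) r' * ?V r') else 0)"
        using st[of "Suc k"] \<open>k < T\<close>
        by (intro sum.cong refl) (simp add: \<xi>0 sum_transition_prob stochastic_at_def sum_pmf_UNIV)
      ultimately have "((\<lambda>x. total_cost (\<xi> x)) has_real_derivative
          visit \<theta> k s * c' + (accrued \<theta> k s + visit \<theta> k s * cost \<theta> (Suc k) s)
           + visit \<theta> k s * (\<Sum>r'\<in>UNIV. pmf (P (Suc k) s i) r' * ?V r')) (at x0)"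
        by simp
      moreover have "visit \<theta> k s * c' + (accrued \<theta> k s + visit \<theta> k s * cost \<theta> (Suc k) s)
           + visit \<theta> k s * (\<Sum>r'\<in>UNIV. pmf (P (Suc k) s i) r' * ?V r') =
          visit \<theta> k s * advantage_grad \<theta> k s i + \<kappa>"
        using True
        by (simp add: \<kappa>_def advantage_grad_def action_value_def c'_def x0_def algebra_simps)
      ultimately show ?thesis by simp
    qed
    then show ?thesis
      by (simp add: partials_def DERIV_imp_deriv \<xi>_def A_def x0_def)
  qed
  then show ?thesis by blast
qed

section \<open>Bounds on visit probabilities\<close>

lemma sum_visit:
  assumes "\<And>t. t \<in> {1..k} \<Longrightarrow> stochastic_at \<theta> t"
  shows "(\<Sum>s\<in>UNIV. visit \<theta> k s) = 1"
  using assms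
proof (induction k)
  case (Suc k)
  have "(\<Sum>s\<in>UNIV. visit \<theta> (Suc k) s) = (\<Sum>r\<in>UNIV. \<Sum>s\<in>UNIV. visit \<theta> k r * step_prob \<theta> (Suc k) r s)"
    unfolding visit.simps by (rule sum.swap)
  with Suc show ?case
    by (simp add: sum_distrib_left[symmetric] sum_transition_prob stochastic_at_def)
qed (simp add: sum_pmf_UNIV)

lemma visit_nonneg:
  assumes "\<And>t r i. t \<in> {1..k} \<Longrightarrow> 0 \<le> \<theta> t $ r $ i"
  shows "0 \<le> visit \<theta> k s"
  using assms
  by (induction k arbitrary: s) (auto simp: transition_prob_def intro!: sum_nonneg mult_nonneg_nonneg)

text \<open>Each transition probability into \<open>s\<close> is an average of base probabilities,
  hence at least \<open>\<delta>\<close>. Averaging over the previous state, whose visit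
  probabilities sum to 1, keeps the bound, so it does not decay with \<open>k\<close>.\<close>

lemma visit_ge:
  assumes st: "\<And>t. t \<in> {1..k} \<Longrightarrow> stochastic_at \<theta> t"
    and nn: "\<And>t r i. t \<in> {1..k} \<Longrightarrow> 0 \<le> \<theta> t $ r $ i"
    and \<rho>: "\<And>r. \<delta> \<le> pmf \<rho> r"
    and P: "\<And>t r i r'. t \<in> {1..k} \<Longrightarrow> \<delta> \<le> pmf (P t r i) r'"
  shows "\<delta> \<le> visit \<theta> k s"
proof (cases k)
  case 0
  then show ?thesis using \<rho> by simp
next
  case (Suc j)
  have p: "\<delta> \<le> step_prob \<theta> k r s" for r
  proof -
    have "\<delta> = (\<Sum>i\<in>UNIV. \<theta> k $ r $ i * \<delta>)"
      using st[of k] Suc by (simp add: sum_distrib_right[symmetric] stochastic_at_def)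
    also have "\<dots> \<le> step_prob \<theta> k r s"
      unfolding transition_prob_def using nn[of k] P[of k] Suc by (intro sum_mono mult_left_mono) auto
    finally show ?thesis .
  qed
  have "\<delta> = (\<Sum>r\<in>UNIV. visit \<theta> j r * \<delta>)"
    using sum_visit[of j \<theta>] st Suc by (simp add: sum_distrib_right[symmetric])
  also have "\<dots> \<le> visit \<theta> k s"
    using p nn Suc by (auto intro!: sum_mono mult_left_mono visit_nonneg)
  finally show ?thesis .
qed

lemma visit_le_1:
  assumes "\<And>t. t \<in> {1..k} \<Longrightarrow> stochastic_at \<theta> t" "\<And>t r i. t \<in> {1..k} \<Longrightarrow> 0 \<le> \<theta> t $ r $ i"
  shows "visit \<theta> k s \<le> 1"
proof -
  have "visit \<theta> k s \<le> (\<Sum>r\<in>UNIV. visit \<theta> k r)"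
    using assms by (intro member_le_sum visit_nonneg) auto
  then show ?thesis using sum_visit[of k \<theta>] assms by simp
qed

lemma stage_policies_le_1:
  assumes "A \<in> stage_policies b" "b > 0"
  shows "A $ s $ i \<le> 1"
proof -
  have "A $ s $ i \<le> (\<Sum>j\<in>UNIV. A $ s $ j)"
    using assms by (intro member_le_sum) (auto simp: stage_policies_def intro: order_trans[of 0 b])
  then show ?thesis using assms by (simp add: stage_policies_def)
qed

section \<open>The gap bound for every normal vector\<close>

text \<open>Each summand of the performance difference is bounded by the squared norm of the
  matching row of gradient plus \<open>g\<close>.\<close>

lemma total_cost_gap_le:
  assumes "T \<ge> 1" "lam > 0" "\<delta> > 0" "b > 0"
    and \<rho>: "\<And>r. \<delta> \<le> pmf \<rho> r"
    and P: "\<And>t r i r'. t \<in> {1..T} \<Longrightarrow> \<delta> \<le> pmf (P t r i) r'"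
    and \<theta>: "\<theta> \<in> policies T b" and \<eta>: "\<eta> \<in> policies T b"
    and g: "g \<in> normal_cone T (policies T b) \<theta>"
  shows "total_cost \<theta> - total_cost \<eta> \<le>
    real CARD('n) / (2 * lam * \<delta>\<^sup>2) * (frobenius_norm T (\<lambda>t. partials total_cost \<theta> t + g t))\<^sup>2"
proof -
  define n where "n = real CARD('n)"
  have "n > 0" by (simp add: n_def)
  define W where "W t = partials total_cost \<theta> t + g t" for t
  have stage: "\<theta> t \<in> stage_policies b" "\<eta> t \<in> stage_policies b" if "t \<in> {1..T}" for t
    using \<theta> \<eta> that by (auto simp: policies_def)
  have st: "stochastic_at \<theta> t" "stochastic_at \<eta> t" if "t \<in> {1..T}" for t
    using stage[OF that] by (auto simp: stochastic_at_def stage_policies_def)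
  have pos: "0 < \<theta> t $ r $ i" "0 < \<eta> t $ r $ i" if "t \<in> {1..T}" for t r i
    using stage[OF that] \<open>b > 0\<close> by (auto simp: stage_policies_def intro: less_le_trans)
  have le1: "\<theta> t $ r $ i \<le> 1" "\<eta> t $ r $ i \<le> 1" if "t \<in> {1..T}" for t r i
    using stage[OF that] \<open>b > 0\<close> by (auto intro: stage_policies_le_1)
  have row: "visit \<eta> k s * advantage \<eta> \<theta> k s \<le> n / (2 * lam * \<delta>\<^sup>2) * (\<Sum>i\<in>UNIV. (W (Suc k) $ s $ i)\<^sup>2)"
    if "k < T" for k s
  proof -
    have t: "Suc k \<in> {1..T}" using that by auto
    define v where "v i = \<theta> (Suc k) $ s $ i - \<eta> (Suc k) $ s $ i" for i
    define w where "w i = W (Suc k) $ s $ i" for i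
    define d where "d = visit \<theta> k s"
    have "\<delta> \<le> d"
      unfolding d_def using that by (intro visit_ge st \<rho> P less_imp_le[OF pos(1)]) auto
    then have "d > 0" using \<open>\<delta> > 0\<close> by simp
    \<comment> \<open>This removes the row constant \<open>\<kappa>\<close> of the gradient.\<close>
    have v0: "(\<Sum>i\<in>UNIV. v i) = 0"
      using st[OF t] by (simp add: v_def sum_subtractf stochastic_at_def)
    have gv: "0 \<le> (\<Sum>i\<in>UNIV. v i * g (Suc k) $ s $ i)"
    proof -
      \<comment> \<open>The constraints are row by row, so replacing row \<open>s\<close> alone by
        that of \<open>\<eta>\<close> stays feasible and isolates this row in the cone
        inequality.\<close>
      define A where "A = (\<chi> r. if r = s then \<eta> (Suc k) $ s else \<theta> (Suc k) $ r)"
      have "A \<in> stage_policies b"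
        using stage[OF t] by (auto simp: A_def stage_policies_def)
      then have "g (Suc k) \<bullet> (A - \<theta> (Suc k)) \<le> 0"
        using g \<theta> t normal_cone_PiE[of \<theta> T "stage_policies b" g] unfolding policies_def by blast
      also have "g (Suc k) \<bullet> (A - \<theta> (Suc k)) =
          (\<Sum>r\<in>UNIV. if r = s then - (\<Sum>i\<in>UNIV. v i * g (Suc k) $ s $ i) else 0)"
        unfolding inner_matrix
        by (intro sum.cong refl) (simp add: A_def v_def sum_negf[symmetric] algebra_simps)
      finally show ?thesis by simp
    qed
    have "\<exists>\<kappa>. \<forall>i. partials total_cost \<theta> (Suc k) $ s $ i = visit \<theta> k s * advantage_grad \<theta> k s i + \<kappa>"
      by (intro partials_total_cost that st(1) pos(1)[OF t])
    then obtain \<kappa> where \<kappa>: "\<And>i. partials total_cost \<theta> (Suc k) $ s $ i = d * advantage_grad \<theta> k s i + \<kappa>"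
      unfolding d_def by blast
    have "(\<Sum>i\<in>UNIV. v i * w i) = d * (\<Sum>i\<in>UNIV. v i * advantage_grad \<theta> k s i)
        + (\<Sum>i\<in>UNIV. v i) * \<kappa> + (\<Sum>i\<in>UNIV. v i * g (Suc k) $ s $ i)"
      by (simp add: w_def W_def \<kappa> sum_distrib_left sum_distrib_right sum.distrib algebra_simps)
    with gv v0 have "d * (\<Sum>i\<in>UNIV. v i * advantage_grad \<theta> k s i) \<le> (\<Sum>i\<in>UNIV. v i * w i)"
      by simp
    then have vq: "(\<Sum>i\<in>UNIV. v i * advantage_grad \<theta> k s i) \<le> (\<Sum>i\<in>UNIV. v i * w i) / d"
      using \<open>d > 0\<close> by (simp add: field_simps)
    have young: "v i * w i / d - lam / n / 2 * (v i)\<^sup>2 \<le> n / (2 * lam * \<delta>\<^sup>2) * (w i)\<^sup>2" for i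
    proof -
      \<comment> \<open>Completing the square: \<open>n / (lam * d) * w i\<close> is the value of
        \<open>v i\<close> that maximizes the left side.\<close>
      have "0 \<le> lam / n / 2 * (v i - n / (lam * d) * w i)\<^sup>2"
        using \<open>lam > 0\<close> \<open>n > 0\<close> by simp
      also have "\<dots> = lam / n / 2 * (v i)\<^sup>2 - v i * w i / d + n / (2 * lam * d\<^sup>2) * (w i)\<^sup>2"
        using \<open>lam > 0\<close> \<open>n > 0\<close> \<open>d > 0\<close> by (simp add: power2_eq_square field_simps)
      finally have "v i * w i / d - lam / n / 2 * (v i)\<^sup>2 \<le> n / (2 * lam * d\<^sup>2) * (w i)\<^sup>2" by simp
      also have "\<dots> \<le> n / (2 * lam * \<delta>\<^sup>2) * (w i)\<^sup>2"
        using \<open>lam > 0\<close> \<open>n > 0\<close> \<open>\<delta> > 0\<close> \<open>\<delta> \<le> d\<close>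
        by (intro mult_right_mono divide_left_mono mult_left_mono power_mono mult_pos_pos) auto
      finally show ?thesis .
    qed
    have "advantage \<eta> \<theta> k s \<le>
        (\<Sum>i\<in>UNIV. v i * advantage_grad \<theta> k s i) - (\<Sum>i\<in>UNIV. lam / n / 2 * (v i)\<^sup>2)"
      using advantage_le[of k \<theta> s \<eta>, OF \<open>lam > 0\<close> that pos(1)[OF t] le1(1)[OF t] pos(2)[OF t] le1(2)[OF t]]
      by (simp add: v_def n_def sum_subtractf)
    also have "\<dots> \<le> (\<Sum>i\<in>UNIV. v i * w i / d - lam / n / 2 * (v i)\<^sup>2)"
      using vq by (simp add: sum_subtractf sum_divide_distrib)
    also have "\<dots> \<le> (\<Sum>i\<in>UNIV. n / (2 * lam * \<delta>\<^sup>2) * (w i)\<^sup>2)"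
      by (intro sum_mono young)
    finally have adv: "advantage \<eta> \<theta> k s \<le> n / (2 * lam * \<delta>\<^sup>2) * (\<Sum>i\<in>UNIV. (w i)\<^sup>2)"
      by (simp add: sum_distrib_left)
    have "0 \<le> visit \<eta> k s"
      using that by (intro visit_nonneg less_imp_le[OF pos(2)]) auto
    \<comment> \<open>The advantage may be negative, so it is first replaced by its nonnegative
      bound; only then is the visit probability bounded by 1.\<close>
    then have "visit \<eta> k s * advantage \<eta> \<theta> k s \<le>
        visit \<eta> k s * (n / (2 * lam * \<delta>\<^sup>2) * (\<Sum>i\<in>UNIV. (w i)\<^sup>2))"
      by (intro mult_left_mono adv)
    also have "\<dots> \<le> n / (2 * lam * \<delta>\<^sup>2) * (\<Sum>i\<in>UNIV. (w i)\<^sup>2)"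
    proof (rule mult_left_le_one_le)
      show "visit \<eta> k s \<le> 1"
        using that by (intro visit_le_1 st less_imp_le[OF pos(2)]) auto
    qed (use \<open>0 \<le> visit \<eta> k s\<close> \<open>lam > 0\<close> \<open>n > 0\<close> in \<open>auto intro!: divide_nonneg_nonneg mult_nonneg_nonneg sum_nonneg\<close>)
    finally show ?thesis by (simp add: w_def)
  qed
  have "total_cost \<theta> - total_cost \<eta> = (\<Sum>k<T. \<Sum>s\<in>UNIV. visit \<eta> k s * advantage \<eta> \<theta> k s)"
    by (intro performance_difference st \<open>T \<ge> 1\<close>)
  also have "\<dots> \<le> (\<Sum>k<T. \<Sum>s\<in>UNIV. n / (2 * lam * \<delta>\<^sup>2) * (\<Sum>i\<in>UNIV. (W (Suc k) $ s $ i)\<^sup>2))"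
    by (intro sum_mono row) auto
  also have "\<dots> = n / (2 * lam * \<delta>\<^sup>2) * (frobenius_norm T W)\<^sup>2"
    unfolding frobenius_norm_def norm_matrix_sq
    by (simp add: sum.atLeast1_atMost_eq sum_nonneg sum_distrib_left)
  finally show ?thesis by (simp add: n_def W_def[abs_def])
qed

end

section \<open>Comparison of constants and conclusion\<close>

text \<open>In the numerator one factor \<open>\<delta>\<close> and \<open>b\<^sup>2\<close> are at
  most 1. In the denominator \<open>L \<ge> lam\<close> cancels two powers of \<open>lam\<close>,
  and the remaining factors are at least \<open>n\<close>.\<close>

lemma PLK_constant_bounds:
  fixes n T :: nat
  assumes "n \<ge> 1" "T \<ge> 1" "lam > 0" "Cbar \<ge> 0" "plow > 0" "\<rho>low > 0" "\<rho>low \<le> 1"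
  shows "0 < PLK_constant n T lam Cbar plow \<rho>low"
    and "PLK_constant n T lam Cbar plow \<rho>low \<le> lam * (min \<rho>low plow)\<^sup>2 / real n"
proof -
  define \<delta> where "\<delta> = min \<rho>low plow"
  define b where "b = theta_low n T lam Cbar"
  define L where "L = 2 * real T * Cbar + lam + lam * real T * ln ((real T * Cbar + lam) / lam)"
  have \<delta>: "0 < \<delta>" "\<delta> \<le> 1" using assms by (auto simp: \<delta>_def)
  have den: "real n * lam > 0" "real n * Cbar * real T \<ge> 0" "real n * lam \<ge> lam"
    using assms by auto
  then have b: "0 < b" "b \<le> 1"
    using \<open>lam > 0\<close> unfolding b_def theta_low_def
    by (auto simp only: divide_le_eq_1_pos add_nonneg_pos intro!: divide_pos_pos)
  have "0 \<le> ln ((real T * Cbar + lam) / lam)"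
    using assms by (intro ln_ge_zero) (simp add: field_simps)
  then have "0 \<le> lam * real T * ln ((real T * Cbar + lam) / lam)" "0 \<le> 2 * real T * Cbar"
    using assms by simp_all
  then have L: "lam \<le> L" unfolding L_def by linarith
  have eq: "PLK_constant n T lam Cbar plow \<rho>low =
      lam ^ 3 * \<delta> ^ 3 * b\<^sup>2 / (exp 1 * real n ^ 4 * (real T)\<^sup>2 * L\<^sup>2)"
    unfolding PLK_constant_def \<delta>_def b_def L_def ..
  show "0 < PLK_constant n T lam Cbar plow \<rho>low"
    unfolding eq using assms \<delta> b L by (intro divide_pos_pos mult_pos_pos) auto
  have "lam ^ 3 * \<delta> ^ 3 * b\<^sup>2 \<le> lam ^ 3 * \<delta>\<^sup>2 * 1"
    using assms \<delta> b by (intro mult_mono mult_left_mono power_decreasing power_le_one) auto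
  moreover have "1 * real n * 1 * lam\<^sup>2 \<le> exp 1 * real n ^ 4 * (real T)\<^sup>2 * L\<^sup>2"
    using assms L by (intro mult_mono power_mono one_le_power) (auto intro: self_le_power)
  ultimately have "PLK_constant n T lam Cbar plow \<rho>low \<le> (lam ^ 3 * \<delta>\<^sup>2 * 1) / (1 * real n * 1 * lam\<^sup>2)"
    unfolding eq using assms \<delta> by (intro frac_le) auto
  also have "\<dots> = lam * \<delta>\<^sup>2 / real n"
    using assms by (simp add: field_simps power2_eq_square power3_eq_cube)
  finally show "PLK_constant n T lam Cbar plow \<rho>low \<le> lam * (min \<rho>low plow)\<^sup>2 / real n"
    by (simp add: \<delta>_def)
qed

theorem theorem2:
  fixes T :: nat
    and lam Cbar plow \<rho>low :: real
    and C :: "nat \<Rightarrow> 'm::finite \<Rightarrow> 'n::finite \<Rightarrow> real"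
    and P :: "nat \<Rightarrow> 'm \<Rightarrow> 'n \<Rightarrow> 'm pmf"
    and \<rho> :: "'m pmf"
    and \<theta>opt :: "nat \<Rightarrow> real^'n^'m"
  assumes "T \<ge> 1"
    and "lam > 0"
    and "plow > 0"
    and "\<rho>low > 0"
    and "\<forall>t\<in>{1..T}. \<forall>s i. 0 \<le> C t s i \<and> C t s i \<le> Cbar"
    and "\<forall>t\<in>{1..T}. \<forall>s i s'. pmf (P t s i) s' \<ge> plow"
    and "\<forall>s. pmf \<rho> s \<ge> \<rho>low"
    and "is_arg_min (expected_cost T lam C P \<rho>)
          (\<lambda>\<theta>. \<theta> \<in> policies T (theta_low CARD('n) T lam Cbar)) \<theta>opt"
  shows "PLK_condition T (expected_cost T lam C P \<rho>)
          (policies T (theta_low CARD('n) T lam Cbar)) \<theta>opt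
          (PLK_constant CARD('n) T lam Cbar plow \<rho>low)"
proof -
  interpret entropy_regularized_mdp T lam C P \<rho> .
  define n where "n = real CARD('n)"
  define \<delta> where "\<delta> = min \<rho>low plow"
  define \<mu> where "\<mu> = PLK_constant CARD('n) T lam Cbar plow \<rho>low"
  define b where "b = theta_low CARD('n) T lam Cbar"
  have "n > 0" by (simp add: n_def)
  have "\<delta> > 0" using assms by (simp add: \<delta>_def)
  \<comment> \<open>Period 1 exists and the types are inhabited, so some cost lies between 0 and
    \<open>Cbar\<close>.\<close>
  have "Cbar \<ge> 0"
    using assms(1) assms(5)[rule_format, of 1 undefined undefined] by simp
  then have "b > 0"
    unfolding b_def theta_low_def using \<open>lam > 0\<close>
    by (intro divide_pos_pos add_nonneg_pos) auto
  have "\<rho>low \<le> 1"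
    using order_trans[OF assms(7)[rule_format, of undefined] pmf_le_1] .
  then have \<mu>: "0 < \<mu>" "\<mu> \<le> lam * \<delta>\<^sup>2 / n"
    unfolding \<mu>_def \<delta>_def n_def
    using assms \<open>Cbar \<ge> 0\<close> by (intro PLK_constant_bounds; simp add: Suc_le_eq)+
  then have "2 * \<mu> \<le> 2 * lam * \<delta>\<^sup>2 / n" by simp
  then have const: "n / (2 * lam * \<delta>\<^sup>2) \<le> 1 / (2 * \<mu>)"
    using \<mu> \<open>n > 0\<close> \<open>\<delta> > 0\<close> \<open>lam > 0\<close> by (simp add: field_simps)
  have "\<exists>g. is_arg_min (\<lambda>g. (frobenius_norm T (\<lambda>t. partials total_cost \<theta> t + g t))\<^sup>2)
                 (\<lambda>g. g \<in> normal_cone T (policies T b) \<theta>) g \<and>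
      total_cost \<theta> - total_cost \<theta>opt \<le> 1 / (2 * \<mu>) * (frobenius_norm T (\<lambda>t. partials total_cost \<theta> t + g t))\<^sup>2"
    if \<theta>: "\<theta> \<in> policies T b" for \<theta>
  proof -
    \<comment> \<open>The gap bound holds for every \<open>g\<close> in the cone, in particular for
      a minimizing one.\<close>
    obtain g where g: "is_arg_min (\<lambda>g. (frobenius_norm T (\<lambda>t. partials total_cost \<theta> t + g t))\<^sup>2)
                 (\<lambda>g. g \<in> normal_cone T (policies T b) \<theta>) g"
      using normal_cone_min_attained[of \<theta> T "stage_policies b" "partials total_cost \<theta>"] \<theta>
      unfolding policies_def by blast
    have "total_cost \<theta> - total_cost \<theta>opt \<le>
        n / (2 * lam * \<delta>\<^sup>2) * (frobenius_norm T (\<lambda>t. partials total_cost \<theta> t + g t))\<^sup>2"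
      unfolding n_def
    proof (rule total_cost_gap_le[OF \<open>T \<ge> 1\<close> \<open>lam > 0\<close> \<open>\<delta> > 0\<close> \<open>b > 0\<close>])
      show "\<delta> \<le> pmf \<rho> r" for r
        using assms(7) by (auto simp: \<delta>_def min_le_iff_disj)
      show "\<delta> \<le> pmf (P t r i) r'" if "t \<in> {1..T}" for t r i r'
        using assms(6) that by (auto simp: \<delta>_def min_le_iff_disj)
      show "\<theta>opt \<in> policies T b" using assms(8) by (simp add: is_arg_min_def b_def)
      show "g \<in> normal_cone T (policies T b) \<theta>" using g by (simp add: is_arg_min_def)
    qed (rule \<theta>)
    also have "\<dots> \<le> 1 / (2 * \<mu>) * (frobenius_norm T (\<lambda>t. partials total_cost \<theta> t + g t))\<^sup>2"
      by (intro mult_right_mono const) simp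
    finally show ?thesis using g by blast
  qed
  then show ?thesis
    unfolding PLK_condition_def using \<mu>(1) by (auto simp: \<mu>_def b_def)
qed

end
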